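(* Assume the Riemann Hypothesis. Let $\alpha$ be a real number. If there exists a positive number $\tau$ such that \[ M_{\tau}(x) = o\big(x^{1/2}(\log x)^{\alpha}\big) \qquad (x\to\infty), \] then every non-trivial zero $\rho$ of the Riemann zeta-function $\zeta(s)$ satisfies $m(\rho) < \alpha + 1$.
   Context: $\mu(n)$ is the Möbius function. For real $\tau \ge 0$ and $x>0$, the Riesz mean is $M_\tau(x) := \frac{1}{\Gamma(\tau+1)}\sum_{n\le x}\mu(n)\left(1-\frac{n}{x}\right)^{\tau}$. For a non-trivial zero $\rho$ of $\zeta(s)$, $m(\rho)$ denotes its multiplicity. *)

theory Defs
  imports "HOL-Complex_Analysis.Complex_Analysis" "HOL-Library.Landau_Symbols"
    "HOL-Computational_Algebra.Squarefree"
begin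

definition moebius :: "nat \<Rightarrow> real" where
  "moebius n = (if squarefree n then (-1) ^ card (prime_factors n) else 0)"

text \<open>The weight \<open>(1 - n/x) ^ \<tau>\<close> is taken to be 1 for \<open>\<tau> = 0\<close>, also when \<open>n = x\<close>;
  the library has \<open>0 powr 0 = 0\<close>, which would drop that term.\<close>

definition riesz_mean :: "real \<Rightarrow> real \<Rightarrow> real" where
  "riesz_mean \<tau> x = 1 / Gamma (\<tau> + 1) *
     (\<Sum>n | 1 \<le> n \<and> real n \<le> x. moebius n * (if \<tau> = 0 then 1 else (1 - real n / x) powr \<tau>))"

text \<open>\<open>\<zeta>\<close> is the analytic continuation to the complex plane without 1 of its Dirichlet series;
  the value 0 at the pole is a convention. Existence and uniqueness are
  \<open>ex_is_zeta\<close> and \<open>is_zeta_unique\<close>.\<close>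

definition is_zeta :: "(complex \<Rightarrow> complex) \<Rightarrow> bool" where
  "is_zeta f \<longleftrightarrow> f holomorphic_on (- {1}) \<and> f 1 = 0 \<and>
     (\<forall>s. Re s > 1 \<longrightarrow> (\<lambda>n. 1 / of_nat (Suc n) powr s) sums f s)"

definition zeta :: "complex \<Rightarrow> complex" where
  "zeta = (THE f. is_zeta f)"

definition nontrivial_zero :: "complex \<Rightarrow> bool" where
  "nontrivial_zero \<rho> \<longleftrightarrow> zeta \<rho> = 0 \<and> 0 < Re \<rho> \<and> Re \<rho> < 1"

definition riemann_hypothesis :: bool where
  "riemann_hypothesis \<longleftrightarrow> (\<forall>\<rho>. nontrivial_zero \<rho> \<longrightarrow> Re \<rho> = 1 / 2)"

lemma suminf_holomorphic_halfplane:
  fixes f :: "nat \<Rightarrow> complex \<Rightarrow> complex" and a :: real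
  assumes hol: "\<And>n. f n holomorphic_on {s. Re s > a}"
    and bound: "\<And>c R. c > a \<Longrightarrow> \<exists>C p. p > 1 \<and> (\<forall>n s. Re s \<ge> c \<and> norm s \<le> R \<longrightarrow>
                  norm (f n s) \<le> C * real (Suc n) powr (-p))"
  shows "(\<lambda>s. \<Sum>n. f n s) holomorphic_on {s. Re s > a}"
    and "\<And>s. Re s > a \<Longrightarrow> summable (\<lambda>n. f n s)"
proof -
  have summable_M: "summable (\<lambda>n. C * real (Suc n) powr (-p))" if "p > 1" for C p
  proof -
    have "summable (\<lambda>n. real n powr (-p))"
      using that by (simp add: summable_real_powr_iff)
    then show ?thesis
      by (intro summable_mult) (subst (asm) summable_Suc_iff [symmetric])
  qed
  show "(\<lambda>s. \<Sum>n. f n s) holomorphic_on {s. Re s > a}"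
  proof (rule holomorphic_uniform_sequence)
    show "open {s. Re s > a}" by (rule open_halfspace_Re_gt)
    show "(\<lambda>s. \<Sum>i<n. f i s) holomorphic_on {s. Re s > a}" for n
      by (intro holomorphic_intros hol)
    fix s0 assume s0: "s0 \<in> {s. Re s > a}"
    define d where "d = (Re s0 - a) / 2"
    have d: "d > 0" "Re s0 - d > a" using s0 by (auto simp: d_def field_simps)
    have re: "Re s \<ge> Re s0 - d" if "s \<in> cball s0 d" for s
      using that abs_Re_le_cmod[of "s0 - s"] by (auto simp: dist_norm)
    have nm: "norm s \<le> norm s0 + d" if "s \<in> cball s0 d" for s
      using that norm_triangle_ineq2[of s s0] by (auto simp: dist_norm norm_minus_commute)
    obtain C p where Cp: "p > 1"
      "\<And>n s. Re s \<ge> Re s0 - d \<Longrightarrow> norm s \<le> norm s0 + d \<Longrightarrow> norm (f n s) \<le> C * real (Suc n) powr (-p)"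
      using bound[OF d(2), of "norm s0 + d"] by blast
    have "uniform_limit (cball s0 d) (\<lambda>n s. \<Sum>i<n. f i s) (\<lambda>s. \<Sum>i. f i s) sequentially"
      by (rule Weierstrass_m_test[OF _ summable_M[OF Cp(1)]]) (use Cp(2) re nm in blast)
    moreover have "cball s0 d \<subseteq> {s. Re s > a}" using re d(2) by fastforce
    ultimately show "\<exists>d>0. cball s0 d \<subseteq> {s. Re s > a} \<and>
        uniform_limit (cball s0 d) (\<lambda>n s. \<Sum>i<n. f i s) (\<lambda>s. \<Sum>i. f i s) sequentially"
      using d(1) by blast
  qed
  show "summable (\<lambda>n. f n s)" if re: "Re s > a" for s
  proof -
    obtain C p where "p > 1" "\<And>n. norm (f n s) \<le> C * real (Suc n) powr (-p)"
      using bound[OF re, of "norm s"] by blast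
    then show ?thesis
      by (intro summable_comparison_test'[OF summable_M[of p C]]) auto
  qed
qed

definition dirichlet :: "complex \<Rightarrow> complex" where
  "dirichlet s = (\<Sum>n. of_nat (Suc n) powr (-s))"

lemma norm_Suc_powr: "norm (of_nat (Suc n) powr s :: complex) = real (Suc n) powr Re s"
  by (subst norm_powr_real_powr) (auto simp del: of_nat_Suc)

lemma dirichlet_props:
  "dirichlet holomorphic_on {s. Re s > 1}"
  "Re s > 1 \<Longrightarrow> (\<lambda>n. of_nat (Suc n) powr (-s)) sums dirichlet s"
proof -
  have *: "\<exists>C p. p > 1 \<and> (\<forall>n s. Re s \<ge> c \<and> norm s \<le> R \<longrightarrow>
       norm (of_nat (Suc n) powr (-s) :: complex) \<le> C * real (Suc n) powr (-p))" if "c > 1" for c R :: real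
    using that by (intro exI[of _ 1] exI[of _ c]) (auto simp: norm_Suc_powr simp del: of_nat_Suc intro!: powr_mono)
  show "dirichlet holomorphic_on {s. Re s > 1}"
    unfolding dirichlet_def by (rule suminf_holomorphic_halfplane[OF _ *]) (auto intro!: holomorphic_intros)
  show "(\<lambda>n. of_nat (Suc n) powr (-s)) sums dirichlet s" if "Re s > 1"
    unfolding dirichlet_def
    by (rule summable_sums, rule suminf_holomorphic_halfplane(2)[OF _ * that]) (auto intro!: holomorphic_intros)
qed

lemma gbinomial_holomorphic [holomorphic_intros]:
  "f holomorphic_on A \<Longrightarrow> (\<lambda>s. f s gchoose k :: complex) holomorphic_on A"
  unfolding gbinomial_prod_rev by (intro holomorphic_intros) auto

lemma gbinomial_Suc_mult:
  "of_nat (Suc k) * (w gchoose Suc k) = (w - of_nat k) * (w gchoose k)" for w :: complex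
  using gbinomial_mult_1[of w k] by (simp add: algebra_simps del: of_nat_Suc)

text \<open>Taylor remainder of \<open>t powr (1 - s)\<close> between \<open>n + 1\<close> and \<open>n + 2\<close>. Its sum over \<open>n\<close> converges
  for \<open>Re s > 1 - K\<close>; telescoping it for \<open>Re s > 1\<close> expresses \<open>(s - 1) \<zeta>(s)\<close> through
  \<open>\<zeta>(s + 1), \<zeta>(s + 2), \<dots>\<close> and thus moves the half-plane of holomorphy to the left step by step.\<close>

definition tayl :: "nat \<Rightarrow> nat \<Rightarrow> complex \<Rightarrow> complex" where
  "tayl K n s = of_nat (Suc (Suc n)) powr (1 - s) -
     (\<Sum>k\<le>K. ((1 - s) gchoose k) * of_nat (Suc n) powr (1 - s - of_nat k))"

lemma norm_tayl:
  assumes c: "c > 1 - real K" and s: "Re s \<ge> c" "norm s \<le> R"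
  shows "norm (tayl K n s) \<le> (\<Prod>i<Suc K. 1 + R + real i) / fact K * real (Suc n) powr (- (c + real K))"
proof -
  define S where "S = closed_segment (of_nat (Suc n)) (of_nat (Suc (Suc n)) :: complex)"
  have S: "\<exists>t. x = of_real t \<and> t \<ge> real (Suc n)" if "x \<in> S" for x
  proof -
    obtain u where "0 \<le> u" "x = (1 - u) *\<^sub>R of_nat (Suc n) + u *\<^sub>R of_nat (Suc (Suc n))"
      using \<open>x \<in> S\<close> unfolding S_def closed_segment_def by blast
    then show ?thesis
      by (intro exI[of _ "real (Suc n) + u"]) (auto simp: scaleR_conv_of_real algebra_simps)
  qed
  define f where "f = (\<lambda>i t. fact i * ((1 - s) gchoose i) * t powr (1 - s - of_nat i))"
  define P where "P = (\<Prod>i<Suc K. 1 + R + real i)"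
  have "norm (f 0 (of_nat (Suc (Suc n))) - (\<Sum>i\<le>K. f i (of_nat (Suc n)) *
              (of_nat (Suc (Suc n)) - of_nat (Suc n)) ^ i / fact i))
     \<le> P * real (Suc n) powr (- (c + real K)) *
          norm (of_nat (Suc (Suc n)) - of_nat (Suc n) :: complex) ^ Suc K / fact K"
  proof (rule complex_Taylor)
    show "convex S" by (simp add: S_def)
    show "of_nat (Suc n) \<in> S" "of_nat (Suc (Suc n)) \<in> S" by (simp_all add: S_def del: of_nat_Suc)
  next
    fix i x assume x: "x \<in> S"
    obtain t where t: "x = of_real t" "t \<ge> real (Suc n)" using S[OF x] by blast
    have nz: "x \<notin> \<real>\<^sub>\<le>\<^sub>0" using t by (auto simp: nonpos_Reals_def)
    have "fact (Suc i) * ((1 - s) gchoose Suc i) = fact i * ((1 - s) gchoose i) * (1 - s - of_nat i)"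
      unfolding fact_Suc using gbinomial_Suc_mult[of i "1 - s"] by (simp add: mult_ac del: of_nat_Suc)
    then have "fact (Suc i) * ((1 - s) gchoose Suc i) * x powr e =
        fact i * ((1 - s) gchoose i) * ((1 - s - of_nat i) * x powr e)" for e
      by (metis mult.assoc)
    moreover have "1 - s - of_nat (Suc i) = 1 - s - of_nat i - 1" by simp
    ultimately have eq: "f (Suc i) x = fact i * ((1 - s) gchoose i) * ((1 - s - of_nat i) * x powr (1 - s - of_nat i - 1))"
      unfolding f_def by metis
    show "(f i has_field_derivative f (Suc i) x) (at x within S)"
      unfolding eq unfolding f_def
      by (intro DERIV_subset[OF DERIV_cmult[OF has_field_derivative_powr[OF nz]]] subset_UNIV)
  next
    fix x assume x: "x \<in> S"
    obtain t where t: "x = of_real t" "t \<ge> real (Suc n)" using S[OF x] by blast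
    have "norm (fact (Suc K) * ((1 - s) gchoose Suc K)) = (\<Prod>i<Suc K. norm (1 - s - of_nat i))"
      unfolding gbinomial_mult_fact prod_norm by (simp add: atLeast0LessThan)
    also have "\<dots> \<le> P" unfolding P_def
    proof (intro prod_mono conjI)
      fix i
      have "norm (1 - s - of_nat i) \<le> norm (1 - s) + norm (of_nat i :: complex)" by (rule norm_triangle_ineq4)
      moreover have "norm (1 - s) \<le> norm (1::complex) + norm s" by (rule norm_triangle_ineq4)
      ultimately show "norm (1 - s - of_nat i) \<le> 1 + R + real i" using s(2) by simp
    qed auto
    finally have 1: "norm (fact (Suc K) * ((1 - s) gchoose Suc K)) \<le> P" .
    have "norm (x powr (1 - s - of_nat (Suc K))) = t powr (- (Re s + real K))"
      using t by (subst norm_powr_real_powr) auto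
    also have "\<dots> \<le> real (Suc n) powr (- (Re s + real K))"
      using t s(1) c by (intro powr_mono2') auto
    also have "\<dots> \<le> real (Suc n) powr (- (c + real K))"
      using s(1) by (intro powr_mono) auto
    finally show "norm (f (Suc K) x) \<le> P * real (Suc n) powr (- (c + real K))"
      unfolding f_def norm_mult[of "_ * _"] using 1 by (intro mult_mono) (auto intro: order_trans[OF norm_ge_zero])
  qed
  also have "f 0 (of_nat (Suc (Suc n))) - (\<Sum>i\<le>K. f i (of_nat (Suc n)) *
              (of_nat (Suc (Suc n)) - of_nat (Suc n)) ^ i / fact i) = tayl K n s"
    by (simp add: f_def tayl_def)
  finally show ?thesis by (simp add: P_def)
qed

lemma tayl_props:
  "(\<lambda>s. \<Sum>n. tayl K n s) holomorphic_on {s. Re s > 1 - real K}"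
  "Re s > 1 - real K \<Longrightarrow> summable (\<lambda>n. tayl K n s)"
proof -
  have *: "\<exists>C p. p > 1 \<and> (\<forall>n s. Re s \<ge> c \<and> norm s \<le> R \<longrightarrow>
       norm (tayl K n s) \<le> C * real (Suc n) powr (-p))" if "c > 1 - real K" for c R :: real
  proof (intro exI conjI allI impI; (elim conjE)?)
    show "1 < c + real K" using that by simp
    show "norm (tayl K n s) \<le> (\<Prod>i<Suc K. 1 + R + real i) / fact K * real (Suc n) powr (- (c + real K))"
      if "c \<le> Re s" "norm s \<le> R" for n s
      by (rule norm_tayl) fact+
  qed
  have hol: "tayl K n holomorphic_on {s. Re s > 1 - real K}" for n
    unfolding tayl_def by (intro holomorphic_intros)
  show "(\<lambda>s. \<Sum>n. tayl K n s) holomorphic_on {s. Re s > 1 - real K}"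
    by (rule suminf_holomorphic_halfplane[OF hol *])
  show "summable (\<lambda>n. tayl K n s)" if "Re s > 1 - real K"
    by (rule suminf_holomorphic_halfplane(2)[OF hol * that])
qed

lemma dirichlet_shift:
  assumes s: "Re s > 1"
  shows "(s - 1) * dirichlet s = 1 + (\<Sum>n. tayl (Suc K) n s) +
           (\<Sum>k<K. ((1 - s) gchoose (k + 2)) * dirichlet (s + of_nat (k + 1)))"
proof -
  define q where "q = (\<lambda>n. of_nat (Suc n) powr (1 - s) :: complex)"
  have "(\<lambda>n. (of_nat (Suc n) :: complex) powr (1 - s)) \<longlonglongrightarrow> 0"
    using s by (intro tendsto_norm_zero_cancel[of "\<lambda>n. (of_nat (Suc n) :: complex) powr (1 - s)"])
      (simp only: norm_Suc_powr, rule tendsto_neg_powr,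
        auto simp del: of_nat_Suc intro!: filterlim_compose[OF filterlim_real_sequentially filterlim_Suc])
  then have "q \<longlonglongrightarrow> 0" by (simp add: q_def)
  from telescope_sums[OF this] have tel: "(\<lambda>n. q (Suc n) - q n) sums (-1)"
    by (simp add: q_def)
  have sums: "(\<lambda>n. ((1 - s) gchoose Suc k) * of_nat (Suc n) powr (1 - s - of_nat (Suc k)))
       sums (((1 - s) gchoose Suc k) * dirichlet (s + of_nat k))" for k
    using dirichlet_props(2)[of "s + of_nat k"] s by (intro sums_mult) (simp add: algebra_simps)
  have "tayl (Suc K) n s = q (Suc n) - q n -
      (\<Sum>k<Suc K. ((1 - s) gchoose Suc k) * of_nat (Suc n) powr (1 - s - of_nat (Suc k)))" for n
    unfolding tayl_def lessThan_Suc_atMost[symmetric] sum.lessThan_Suc_shift[of _ "Suc K"]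
    by (simp add: q_def)
  then have "(\<lambda>n. tayl (Suc K) n s) sums
      (-1 - (\<Sum>k<Suc K. ((1 - s) gchoose Suc k) * dirichlet (s + of_nat k)))"
    by (simp only:, intro sums_diff[OF tel] sums_sum sums)
  then have "(\<Sum>n. tayl (Suc K) n s) = -1 - (\<Sum>k<Suc K. ((1 - s) gchoose Suc k) * dirichlet (s + of_nat k))"
    by (simp add: sums_iff)
  then show ?thesis
    unfolding sum.lessThan_Suc_shift by (simp add: algebra_simps)
qed

lemma divide_mult_regroup:
  "a = - u * b / c \<Longrightarrow> x = u * d \<Longrightarrow> a * d = - b / c * x" for a b c d u x :: complex
  by simp

lemma zeta_continuation_step:
  "\<exists>F. F holomorphic_on {s. Re s > 1 - real K} \<and> (\<forall>s. Re s > 1 \<longrightarrow> F s = (s - 1) * dirichlet s)"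
proof (induction K)
  case 0
  show ?case
    by (intro exI[of _ "\<lambda>s. (s - 1) * dirichlet s"]) (auto intro!: holomorphic_intros dirichlet_props)
next
  case (Suc K)
  then obtain F where F: "F holomorphic_on {s. Re s > 1 - real K}"
    "\<And>s. Re s > 1 \<Longrightarrow> F s = (s - 1) * dirichlet s" by blast
  define G where "G = (\<lambda>s. 1 + (\<Sum>n. tayl (Suc K) n s) +
           (\<Sum>k<K. - ((1 - s) gchoose (k + 1)) / of_nat (k + 2) * F (s + of_nat (k + 1))))"
  have "(F \<circ> (\<lambda>s. s + of_nat (k + 1))) holomorphic_on {s. Re s > 1 - real (Suc K)}" for k
    by (rule holomorphic_on_compose_gen[OF _ F(1)]) (auto intro!: holomorphic_intros)
  then have "G holomorphic_on {s. Re s > 1 - real (Suc K)}"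
    unfolding G_def o_def by (intro holomorphic_intros tayl_props) (auto simp del: of_nat_Suc of_nat_add)
  moreover have "G s = (s - 1) * dirichlet s" if s: "Re s > 1" for s
  proof -
    have "((1 - s) gchoose (k + 2)) * dirichlet (s + of_nat (k + 1)) =
          - ((1 - s) gchoose (k + 1)) / of_nat (k + 2) * F (s + of_nat (k + 1))" for k
    proof -
      have nz: "of_nat (k + 2) \<noteq> (0 :: complex)" by (simp only: of_nat_eq_0_iff)
      have "of_nat (k + 2) * ((1 - s) gchoose (k + 2)) = - (s + of_nat (k + 1) - 1) * ((1 - s) gchoose (k + 1))"
        using gbinomial_Suc_mult[of "k + 1" "1 - s"] by (simp del: of_nat_Suc)
      then have "(1 - s) gchoose (k + 2) = - (s + of_nat (k + 1) - 1) * ((1 - s) gchoose (k + 1)) / of_nat (k + 2)"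
        using nz by (metis nonzero_mult_div_cancel_left)
      then show ?thesis
      proof (rule divide_mult_regroup)
        show "F (s + of_nat (k + 1)) = (s + of_nat (k + 1) - 1) * dirichlet (s + of_nat (k + 1))"
          using s by (intro F(2)) simp
      qed
    qed
    then show ?thesis unfolding G_def dirichlet_shift[OF s, of K] by simp
  qed
  ultimately show ?case by blast
qed

lemma is_zeta_unique:
  assumes f: "is_zeta f" and g: "is_zeta g"
  shows "f = g"
proof
  fix z
  show "f z = g z"
  proof (cases "z = 1")
    case False
    show ?thesis
    proof (rule analytic_continuation_open[of "{s. Re s > 1}" "- {1}" f g])
      show "connected (- {1 :: complex})" by (rule connected_punctured_universe) simp
      show "f s = g s" if "s \<in> {s. Re s > 1}" for s
        using that f g unfolding is_zeta_def by (auto intro: sums_unique2)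
      show "{s. Re s > 1} \<noteq> {}" by (auto intro: exI[of _ "2 :: complex"])
    qed (use f g False in \<open>auto simp: is_zeta_def open_halfspace_Re_gt\<close>)
  qed (use f g in \<open>simp add: is_zeta_def\<close>)
qed

lemma ex_is_zeta: "\<exists>f. is_zeta f"
proof -
  obtain F where F: "\<And>K. F K holomorphic_on {s. Re s > 1 - real K}"
    "\<And>K s. Re s > 1 \<Longrightarrow> F K s = (s - 1) * dirichlet s"
    using zeta_continuation_step by metis
  have agree: "F K s = F L s" if KL: "K \<le> L" and s: "Re s > 1 - real K" for K L s
  proof (rule analytic_continuation_open[of "{s. Re s > 1}" "{s. Re s > 1 - real K}" "F K" "F L"])
    show "F L holomorphic_on {s. Re s > 1 - real K}"
      using KL by (intro holomorphic_on_subset[OF F(1)[of L]]) auto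
    show "{s. Re s > 1} \<noteq> {}" by (auto intro: exI[of _ "2 :: complex"])
    show "connected {s. Re s > 1 - real K}" by (intro convex_connected convex_halfspace_Re_gt)
  qed (use F s in \<open>auto simp: open_halfspace_Re_gt\<close>)
  define m where "m = (\<lambda>s. nat \<lceil>1 - Re s\<rceil> + 1)"
  have m: "Re s > 1 - real (m s)" for s unfolding m_def by linarith
  define f where "f = (\<lambda>s. if s = 1 then 0 else F (m s) s / (s - 1))"
  have Fm: "F (m s) s = F K s" if "Re s > 1 - real K" for s K
  proof (cases "K \<le> m s")
    case True
    show ?thesis by (rule agree[OF True that, symmetric])
  next
    case False
    then have "m s \<le> K" by simp
    then show ?thesis by (rule agree) (rule m)
  qed
  have fF: "f s = F K s / (s - 1)" if "s \<noteq> 1" "Re s > 1 - real K" for s K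
    using Fm[OF that(2)] that(1) by (simp add: f_def)
  have "f holomorphic_on (\<Union>K. {s. Re s > 1 - real K} - {1})"
  proof (rule holomorphic_on_UN_open)
    show "f holomorphic_on {s. Re s > 1 - real K} - {1}" for K
    proof (rule holomorphic_transform)
      show "(\<lambda>s. F K s / (s - 1)) holomorphic_on {s. Re s > 1 - real K} - {1}"
        by (intro holomorphic_intros holomorphic_on_subset[OF F(1)[of K]]) auto
    next
      fix s assume "s \<in> {s. Re s > 1 - real K} - {1}"
      then show "F K s / (s - 1) = f s" by (intro fF[symmetric]) auto
    qed
    show "open ({s. Re s > 1 - real K} - {1})" for K
      by (intro open_Diff open_halfspace_Re_gt) auto
  qed
  also have "(\<Union>K. {s. Re s > 1 - real K} - {1}) = - {1}" using m by blast
  finally have "f holomorphic_on - {1}" .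
  moreover have "f s = dirichlet s" if "Re s > 1" for s
  proof -
    have "s \<noteq> 1" using that by auto
    moreover have "f s = F 0 s / (s - 1)" by (rule fF) (use that in auto)
    ultimately show ?thesis using F(2)[OF that, of 0] by simp
  qed
  ultimately have "is_zeta f"
    using dirichlet_props(2) unfolding is_zeta_def
    by (auto simp: f_def powr_minus divide_inverse simp del: of_nat_Suc)
  then show ?thesis by blast
qed

lemma is_zeta_zeta: "is_zeta zeta"
  unfolding zeta_def by (rule theI'[of is_zeta]) (intro ex_ex1I ex_is_zeta is_zeta_unique)

end

theory Submission
  imports Defs
begin

text \<open>The Laplace transform \<open>F\<close> of \<open>M\<^sub>\<tau>(e\<^sup>t)\<close> satisfies \<open>F(s) \<zeta>(s) = \<Gamma>(s) / \<Gamma>(s + \<tau> + 1)\<close> for real \<open>s > 1\<close>, by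
  integrating term by term. The growth hypothesis makes \<open>F\<close> holomorphic on \<open>Re s > 1/2\<close>, so the
  identity extends there. Approaching a zero \<open>\<rho>\<close> with \<open>Re \<rho> = 1/2\<close> along \<open>s = \<rho> + \<delta>\<close>, \<open>\<delta> \<rightarrow> 0+\<close>, the same
  hypothesis yields \<open>F(s) = o(\<delta> powr (-\<alpha> - 1))\<close> when \<open>\<alpha> > -1\<close>, while \<open>\<zeta>(s) = O(\<delta> ^ m(\<rho>))\<close>. The right-hand
  side has a nonzero limit, which forces \<open>m(\<rho>) < \<alpha> + 1\<close>.\<close>

section \<open>The reciprocal of zeta on the real axis\<close>

lemma moebius_prime_mult:
  assumes p: "prime p" and "\<not> p dvd n"
  shows "moebius (p * n) = - moebius n"
proof -
  have n: "n \<noteq> 0" using assms by (metis dvd_0_right)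
  have cop: "coprime p n" using assms by (simp add: prime_imp_coprime)
  have "prime_factors (p * n) = insert p (prime_factors n)"
    using p n by (auto simp: prime_factors_product prime_prime_factors)
  moreover have "p \<notin> prime_factors n" using assms by auto
  moreover have "squarefree (p * n) \<longleftrightarrow> squarefree n"
    using cop p squarefree_mult_coprime squarefree_prime squarefree_mono dvd_triv_right by metis
  ultimately show ?thesis
    by (simp add: moebius_def)
qed

lemma moebius_1 [simp]: "moebius (Suc 0) = 1"
  by (simp add: moebius_def)

lemma abs_moebius_le_1: "\<bar>moebius n\<bar> \<le> 1"
  by (simp add: moebius_def)

lemma sum_moebius_divisors:
  assumes n: "n > 0"
  shows "(\<Sum>d | d dvd n. moebius d) = (if n = 1 then 1 else 0)"
proof (cases "n = 1")
  case True
  then show ?thesis by simp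
next
  case False
  then obtain p where p: "prime p" "p dvd n" using prime_factor_nat by blast
  \<comment> \<open>\<open>d \<mapsto> p d\<close> pairs the squarefree divisors prime to \<open>p\<close> with those divisible by \<open>p\<close>.\<close>
  define A where "A = {d. d dvd n \<and> \<not> p dvd d}"
  define B where "B = {d. d dvd n \<and> p dvd d \<and> squarefree d}"
  have fin: "finite {d. d dvd n}" using n by simp
  have finAB: "finite A" "finite B" by (auto simp: A_def B_def intro: finite_subset[OF _ fin])
  \<comment> \<open>Multiples of \<open>p\<close> that are not squarefree contribute 0, so
    \<open>B\<close> may leave them out.\<close>
  have "(\<Sum>d | d dvd n. moebius d) = (\<Sum>d\<in>A \<union> B. moebius d)"
    by (rule sum.mono_neutral_right[OF fin]) (auto simp: A_def B_def moebius_def)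
  also have "\<dots> = (\<Sum>d\<in>A. moebius d) + (\<Sum>d\<in>B. moebius d)"
    by (rule sum.union_disjoint) (use finAB in \<open>auto simp: A_def B_def\<close>)
  also have "(\<Sum>d\<in>B. moebius d) = (\<Sum>d\<in>{d\<in>A. squarefree d}. moebius (p * d))"
  proof (rule sum.reindex_bij_witness[of _ "\<lambda>d. p * d" "\<lambda>d. d div p"])
    fix d assume d: "d \<in> B"
    then obtain k where k: "d = p * k" by (auto simp: B_def)
    have k': "d div p = k" using k p by auto
    have "\<not> p dvd k"
    proof
      assume "p dvd k"
      then have "p\<^sup>2 dvd d" by (auto simp: k power2_eq_square)
      then have "is_unit p" using d by (auto simp: B_def dest: squarefreeD)
      then show False using p by auto
    qed
    moreover have "k dvd n" "squarefree k" using d k squarefree_mono[of k d]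
      by (auto simp: B_def dest: dvd_mult_right)
    ultimately show "d div p \<in> {d\<in>A. squarefree d}" using k' by (simp add: A_def)
    show "p * (d div p) = d" using k k' by simp
    then show "moebius (p * (d div p)) = moebius d" by simp
  next
    fix d assume d: "d \<in> {d\<in>A. squarefree d}"
    then have cop: "coprime p d" using p by (simp add: A_def prime_imp_coprime)
    then have "p * d dvd n" using d p by (simp add: A_def divides_mult)
    moreover have "squarefree (p * d)"
      using cop p d squarefree_prime squarefree_mult_coprime by auto
    ultimately show "p * d \<in> B" by (simp add: B_def)
    show "p * d div p = d" using p by auto
  qed
  also have "\<dots> = (\<Sum>d\<in>{d\<in>A. squarefree d}. - moebius d)"
    using p by (intro sum.cong refl moebius_prime_mult) (auto simp: A_def)
  \<comment> \<open>The non-squarefree elements of \<open>A\<close> return with value 0, so that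
    this sum cancels the one over \<open>A\<close>.\<close>
  also have "\<dots> = (\<Sum>d\<in>A. - moebius d)"
    by (rule sum.mono_neutral_left) (use finAB in \<open>auto simp: moebius_def\<close>)
  finally show ?thesis using False by (simp add: sum_negf)
qed

section \<open>Dirichlet series at real \<open>s > 1\<close>\<close>

lemma summable_Suc_powr: "s > 1 \<Longrightarrow> summable (\<lambda>n. real (Suc n) powr (-s))"
  using summable_real_powr_iff[of "-s"] by (subst (asm) summable_Suc_iff [symmetric]) simp

lemma zeta_of_real:
  assumes s: "s > 1"
  shows "zeta (of_real s) = of_real (\<Sum>n. real (Suc n) powr (-s))"
proof -
  have "1 / of_nat (Suc n) powr of_real s = (of_real (real (Suc n) powr (-s)) :: complex)" for n
    using powr_of_real[of "real (Suc n)" s]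
    by (simp del: of_nat_Suc add: powr_minus divide_inverse)
  moreover have "(\<lambda>n. 1 / of_nat (Suc n) powr of_real s) sums zeta (of_real s)"
    using is_zeta_zeta s by (simp add: is_zeta_def)
  ultimately have "(\<lambda>n. of_real (real (Suc n) powr (-s))) sums zeta (of_real s)" by simp
  moreover have "(\<lambda>n. of_real (real (Suc n) powr (-s)) :: complex) sums
      of_real (\<Sum>n. real (Suc n) powr (-s))"
    using summable_Suc_powr[OF s] by (intro sums_of_real summable_sums)
  ultimately show ?thesis by (rule sums_unique2)
qed

text \<open>Unordered form of the series, ready for regrouping a double sum. Taking
  \<open>Re\<close> costs nothing because zeta is real at real arguments
  \<open>s > 1\<close>.\<close>

lemma has_sum_zeta_real:
  assumes s: "s > 1"
  shows "((\<lambda>n. real n powr (-s)) has_sum Re (zeta (of_real s))) {0<..}"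
proof -
  have "(\<lambda>n. real (Suc n) powr (-s)) sums Re (zeta (of_real s))"
    unfolding zeta_of_real[OF s] Re_complex_of_real by (intro summable_sums summable_Suc_powr s)
  then have "((\<lambda>n. real (Suc n) powr (-s)) has_sum Re (zeta (of_real s))) UNIV"
    by (intro sums_nonneg_imp_has_sum) auto
  also have "?this \<longleftrightarrow> ?thesis"
    by (rule has_sum_reindex_bij_witness[of UNIV "\<lambda>n. n - 1" Suc]) auto
  finally show ?thesis .
qed

text \<open>Multiplying the series of the Moebius function by that of zeta and collecting terms with
  equal product \<open>k\<close> leaves the divisor sum of the Moebius function as the coefficient
  of \<open>k powr (-s)\<close>. Only \<open>k = 1\<close> survives, so the product is 1.\<close>

lemma sums_moebius_powr:
  assumes s: "s > 1"
  shows "zeta (of_real s) \<noteq> 0"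
    and "(\<lambda>n. moebius (Suc n) * real (Suc n) powr (-s)) sums (1 / Re (zeta (of_real s)))"
proof -
  define P where "P = {0::nat<..}"
  define f where "f = (\<lambda>n. moebius n * real n powr (-s))"
  define g where "g = (\<lambda>n. real n powr (-s))"
  have g: "(g has_sum Re (zeta (of_real s))) P"
    using has_sum_zeta_real[OF s] by (simp add: g_def P_def)
  then have gsum: "g summable_on P" by (rule has_sum_imp_summable)
  have fg: "\<bar>f n\<bar> \<le> g n" for n
    using mult_right_mono[OF abs_moebius_le_1[of n], of "real n powr (-s)"]
    by (simp add: f_def g_def abs_mult)
  have fs: "f summable_on P"
    by (rule summable_on_comparison_test[OF gsum, THEN abs_summable_summable])
      (use fg in auto)
  \<comment> \<open>Comparison with the square of the zeta series gives absolute convergence of the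
    double series, which permits the regrouping.\<close>
  have "(\<lambda>(m,n). g m * g n) summable_on P \<times> P"
  proof (rule summable_on_SigmaI)
    show "((\<lambda>n. case (m, n) of (m, n) \<Rightarrow> g m * g n) has_sum g m * Re (zeta (of_real s))) P" for m
      using has_sum_cmult_right[OF g, of "g m"] by simp
    show "(\<lambda>m. g m * Re (zeta (of_real s))) summable_on P"
      using gsum by (rule summable_on_cmult_left)
  qed (simp add: g_def)
  then have ss: "(\<lambda>(m,n). f m * g n) summable_on P \<times> P"
  proof (rule summable_on_comparison_test[THEN abs_summable_summable])
    show "norm (case p of (m, n) \<Rightarrow> f m * g n) \<le> (case p of (m, n) \<Rightarrow> g m * g n)" for p
      using fg by (cases p) (auto simp: abs_mult g_def intro!: mult_right_mono)
  qed auto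
  define M where "M = infsum f P"
  have fM: "(f has_sum M) P"
    using fs by (simp add: M_def)
  have "infsum (\<lambda>(m,n). f m * g n) (P \<times> P) = infsum (\<lambda>m. infsum (\<lambda>n. f m * g n) P) P"
    by (rule infsum_Sigma'_banach[OF ss, symmetric])
  also have "\<dots> = infsum (\<lambda>m. f m * Re (zeta (of_real s))) P"
    using g by (intro infsum_cong infsumI has_sum_cmult_right)
  also have "\<dots> = M * Re (zeta (of_real s))"
    using fM by (intro infsumI has_sum_cmult_left)
  finally have "((\<lambda>(m,n). f m * g n) has_sum M * Re (zeta (of_real s))) (P \<times> P)"
    using ss by (metis has_sum_infsum)
  \<comment> \<open>A pair \<open>(m, n)\<close> is recoded as \<open>(k, d) = (m * n, m)\<close>,
    so \<open>d\<close> runs through the divisors of \<open>k\<close>.\<close>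
  also have "?this \<longleftrightarrow> ((\<lambda>(k,d). moebius d * real k powr (-s)) has_sum M * Re (zeta (of_real s)))
       (Sigma P (\<lambda>k. {d. d dvd k}))"
    by (rule has_sum_reindex_bij_witness[of _ "\<lambda>(k,d). (d, k div d)" "\<lambda>(m,n). (m * n, m)"])
      (auto simp: P_def f_def g_def powr_mult)
  finally have "((\<lambda>k. \<Sum>d | d dvd k. moebius d * real k powr (-s)) has_sum M * Re (zeta (of_real s))) P"
    by (rule has_sum_SigmaD) (auto simp: P_def intro!: has_sum_finite)
  also have "?this \<longleftrightarrow> ((\<lambda>k. if k = 1 then 1 else 0) has_sum M * Re (zeta (of_real s))) P"
    by (rule has_sum_cong) (auto simp: P_def sum_moebius_divisors simp flip: sum_distrib_right)
  finally have "((\<lambda>k. if k = 1 then 1 else 0) has_sum M * Re (zeta (of_real s))) P" .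
  moreover have "((\<lambda>k::nat. if k = 1 then 1 else 0) has_sum (1::real)) P"
    by (rule has_sum_finite_neutralI[of "{1}"]) (auto simp: P_def)
  ultimately have eq: "M * Re (zeta (of_real s)) = 1" by (rule has_sum_unique)
  then show "zeta (of_real s) \<noteq> 0" by auto
  have "(f has_sum M) P \<longleftrightarrow> ((\<lambda>n. f (Suc n)) has_sum M) UNIV"
    by (rule has_sum_reindex_bij_witness[of _ Suc "\<lambda>n. n - 1"]) (auto simp: P_def)
  then have "(\<lambda>n. f (Suc n)) sums M" using fM by (auto intro: has_sum_imp_sums)
  moreover have "M = 1 / Re (zeta (of_real s))" using eq by (metis eq_divide_eq mult_zero_right zero_neq_one)
  ultimately show "(\<lambda>n. moebius (Suc n) * real (Suc n) powr (-s)) sums (1 / Re (zeta (of_real s)))"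
    by (simp add: f_def)
qed

section \<open>Laplace transforms\<close>

text \<open>The integral runs over the whole line. It is applied to functions vanishing for
  \<open>t < 0\<close>, for which it is the usual one-sided transform.\<close>

definition laplace :: "(real \<Rightarrow> real) \<Rightarrow> complex \<Rightarrow> complex" where
  "laplace f s = (LINT t|lborel. of_real (f t) * exp (- (s * of_real t)))"

lemma norm_laplace_integrand:
  "norm (of_real (f t) * exp (- (s * of_real t)) :: complex) = \<bar>f t\<bar> * exp (- (Re s * t))"
  by (simp add: norm_mult)

text \<open>The modulus of the integrand depends on \<open>s\<close> only through
  \<open>Re s\<close>, which reduces the claim to the real exponent.\<close>

lemma laplace_integrable:
  assumes "integrable lborel (\<lambda>t. f t * exp (- (Re s * t)))"
  shows "integrable lborel (\<lambda>t. of_real (f t) * exp (- (s * of_real t)) :: complex)"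
proof -
  define g where "g = (\<lambda>t. f t * exp (- (Re s * t)))"
  have [measurable]: "g \<in> borel_measurable borel"
    using borel_measurable_integrable[OF assms] by (simp add: g_def)
  \<comment> \<open>Measurability of \<open>f\<close> is recovered from the integrable product by
    undoing the exponential factor.\<close>
  have "f = (\<lambda>t. g t * exp (Re s * t))"
    by (simp add: g_def fun_eq_iff exp_minus)
  also have "\<dots> \<in> borel_measurable borel" by measurable
  finally have [measurable]: "f \<in> borel_measurable borel" .
  show ?thesis
    by (rule Bochner_Integration.integrable_bound[OF assms])
      (auto simp: norm_laplace_integrand abs_mult simp del: norm_mult)
qed

text \<open>Mean value bound: the derivative in \<open>s\<close> has modulus at most
  \<open>t * exp (- ((c + \<eta>) * t))\<close>, and
  \<open>\<eta> * t \<le> exp (\<eta> * t)\<close> absorbs the factor \<open>t\<close>. The bound is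
  uniform in \<open>s\<close> and \<open>w\<close>, as dominated convergence of difference quotients
  requires.\<close>

lemma norm_exp_diff_quotient_le:
  fixes s w :: complex
  assumes "Re s \<ge> c + \<eta>" "Re w \<ge> c + \<eta>" "\<eta> > 0" "t \<ge> 0"
  shows "norm ((exp (- (s * of_real t)) - exp (- (w * of_real t))) / (s - w)) \<le> exp (- (c * t)) / \<eta>"
proof -
  have "norm (exp (- (s * of_real t)) - exp (- (w * of_real t))) \<le> exp (- (c * t)) / \<eta> * norm (s - w)"
  proof (rule field_differentiable_bound)
    show "convex {s. Re s \<ge> c + \<eta>}" by (rule convex_halfspace_Re_ge)
    fix z :: complex assume z: "z \<in> {s. Re s \<ge> c + \<eta>}"
    show "((\<lambda>s. exp (- (s * of_real t))) has_field_derivative - (of_real t * exp (- (z * of_real t))))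
        (at z within {s. Re s \<ge> c + \<eta>})"
      by (auto intro!: derivative_eq_intros)
    have "\<eta> * t \<le> exp (\<eta> * t)" using exp_ge_add_one_self[of "\<eta> * t"] by linarith
    then have "t \<le> exp (\<eta> * t) / \<eta>" using assms(3) by (simp add: field_simps)
    moreover have "exp (- (Re z * t)) \<le> exp (- ((c + \<eta>) * t))"
      using z assms(4) by (simp add: mult_right_mono)
    ultimately have "t * exp (- (Re z * t)) \<le> exp (\<eta> * t) / \<eta> * exp (- ((c + \<eta>) * t))"
      using assms(4) by (intro mult_mono) auto
    also have "\<dots> = exp (- (c * t)) / \<eta>" by (simp add: mult_exp_exp algebra_simps)
    finally show "norm (- (of_real t * exp (- (z * of_real t)))) \<le> exp (- (c * t)) / \<eta>"
      using assms(4) by (simp add: norm_mult)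
  qed (use assms in auto)
  \<comment> \<open>For \<open>s = w\<close> the quotient is 0, since division by 0 yields
    0.\<close>
  then show ?thesis using assms(3) by (cases "s = w") (auto simp: norm_divide divide_simps)
qed

text \<open>Differentiation under the integral sign, by dominated convergence of the difference
  quotients along sequences.\<close>

lemma laplace_holomorphic:
  assumes int: "\<And>\<sigma>. \<sigma> > a \<Longrightarrow> integrable lborel (\<lambda>t. f t * exp (- (\<sigma> * t)))"
    and neg: "\<And>t. t < 0 \<Longrightarrow> f t = 0"
  shows "laplace f holomorphic_on {s. Re s > a}"
proof (rule holomorphic_onI)
  fix z assume "z \<in> {s. Re s > a}"
  \<comment> \<open>With a third of the distance to the boundary, \<open>c = a + \<eta>\<close> is
    still admissible for \<open>int\<close>, and the ball of radius \<open>\<eta>\<close> around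
    \<open>z\<close> stays in \<open>Re s \<ge> c + \<eta>\<close>.\<close>
  define \<eta> where "\<eta> = (Re z - a) / 3"
  define c where "c = Re z - 2 * \<eta>"
  have \<eta>: "\<eta> > 0" and c: "c > a" using \<open>z \<in> _\<close> by (auto simp: \<eta>_def c_def field_simps)
  have re: "Re s \<ge> c + \<eta>" if "s \<in> ball z \<eta>" for s
    using that abs_Re_le_cmod[of "z - s"] by (auto simp: c_def dist_norm)
  define h where "h = (\<lambda>s t. of_real (f t) * exp (- (s * of_real t)) :: complex)"
  have hint: "integrable lborel (h s)" if "s \<in> ball z \<eta>" for s
    unfolding h_def using re[OF that] c \<eta> by (intro laplace_integrable int) auto
  have lap: "laplace f s = (LINT t|lborel. h s t)" for s by (simp add: laplace_def h_def)
  \<comment> \<open>The derivative of the integrand with respect to \<open>s\<close> at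
    \<open>z\<close>.\<close>
  define D where "D = (\<lambda>t. - of_real t * h z t)"
  have "((\<lambda>s. (laplace f s - laplace f z) / (s - z)) \<longlongrightarrow> (LINT t|lborel. D t)) (at z within ball z \<eta>)"
    unfolding tendsto_at_iff_sequentially o_def
  proof safe
    fix X :: "nat \<Rightarrow> complex"
    assume X: "\<forall>i. X i \<in> ball z \<eta> - {z}" "X \<longlonglongrightarrow> z"
    have "(\<lambda>i. LINT t|lborel. (h (X i) t - h z t) / (X i - z)) \<longlonglongrightarrow> (LINT t|lborel. D t)"
    proof (rule integral_dominated_convergence)
      show "integrable lborel (\<lambda>t. \<bar>f t * exp (- (c * t))\<bar> / \<eta>)"
        using int[OF c] by auto
      have [measurable]: "h z \<in> borel_measurable borel" "\<And>i. h (X i) \<in> borel_measurable borel"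
        using hint[of z] hint[of "X _"] X \<eta> by (auto dest: borel_measurable_integrable)
      show "D \<in> borel_measurable lborel" unfolding D_def by measurable
      show "(\<lambda>t. (h (X i) t - h z t) / (X i - z)) \<in> borel_measurable lborel" for i by measurable
      show "AE t in lborel. (\<lambda>i. (h (X i) t - h z t) / (X i - z)) \<longlonglongrightarrow> D t"
      proof (rule AE_I2)
        fix t
        have "((\<lambda>s. h s t) has_field_derivative D t) (at z)"
          unfolding h_def D_def by (auto intro!: derivative_eq_intros)
        then have "((\<lambda>s. (h s t - h z t) / (s - z)) \<longlongrightarrow> D t) (at z)"
          by (simp add: has_field_derivative_iff)
        then show "(\<lambda>i. (h (X i) t - h z t) / (X i - z)) \<longlonglongrightarrow> D t"
          using X unfolding tendsto_at_iff_sequentially o_def by auto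
      qed
      show "AE t in lborel. norm ((h (X i) t - h z t) / (X i - z)) \<le> \<bar>f t * exp (- (c * t))\<bar> / \<eta>" for i
      proof (rule AE_I2)
        fix t
        show "norm ((h (X i) t - h z t) / (X i - z)) \<le> \<bar>f t * exp (- (c * t))\<bar> / \<eta>"
        proof (cases "t \<ge> 0")
          case True
          have "norm ((h (X i) t - h z t) / (X i - z)) =
              \<bar>f t\<bar> * norm ((exp (- (X i * of_real t)) - exp (- (z * of_real t))) / (X i - z))"
            by (simp add: h_def norm_mult norm_divide flip: right_diff_distrib)
          also have "\<dots> \<le> \<bar>f t\<bar> * (exp (- (c * t)) / \<eta>)"
            using re[of "X i"] re[of z] X \<eta> True by (intro mult_left_mono norm_exp_diff_quotient_le) auto
          finally show ?thesis by (simp add: abs_mult)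
        qed (simp add: h_def neg)
      qed
    qed
    also have "(\<lambda>i. LINT t|lborel. (h (X i) t - h z t) / (X i - z)) =
        (\<lambda>i. (laplace f (X i) - laplace f z) / (X i - z))"
      using hint X \<eta> by (simp add: lap)
    finally show "(\<lambda>i. (laplace f (X i) - laplace f z) / (X i - z)) \<longlonglongrightarrow> (LINT t|lborel. D t)" .
  qed
  then have "(laplace f has_field_derivative (LINT t|lborel. D t)) (at z within ball z \<eta>)"
    by (simp add: has_field_derivative_iff)
  then have "(laplace f has_field_derivative (LINT t|lborel. D t)) (at z)"
    using at_within_open[of z "ball z \<eta>"] \<eta> by simp
  then show "laplace f field_differentiable at z within {s. Re s > a}"
    using field_differentiable_def field_differentiable_at_within by blast
qed

section \<open>Gamma and Beta integrals as Laplace transforms\<close>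

text \<open>Euler's integral for \<open>Gamma (\<alpha> + 1)\<close>, rescaled by the factor
  \<open>d\<close>. The condition on \<open>\<alpha>\<close> gives convergence at 0.\<close>

lemma has_bochner_integral_powr_exp:
  fixes \<alpha> d :: real
  assumes \<alpha>: "\<alpha> > -1" and d: "d > 0"
  shows "has_bochner_integral lborel (\<lambda>t. indicator {0..} t * t powr \<alpha> * exp (- (d * t)))
    (Gamma (\<alpha> + 1) * d powr (- \<alpha> - 1))"
proof -
  define f where "f = (\<lambda>t::real. indicator {0..} t * t powr \<alpha> / exp t)"
  have "has_bochner_integral lborel f (Gamma (\<alpha> + 1))"
  proof (rule has_bochner_integral_nn_integral)
    show "f \<in> borel_measurable lborel" unfolding f_def by measurable
    show "nn_integral lborel (\<lambda>x. ennreal (f x)) = ennreal (Gamma (\<alpha> + 1))"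
      using Gamma_conv_nn_integral_real[of "\<alpha> + 1"] \<alpha> by (simp add: f_def)
  qed (use \<alpha> in \<open>auto simp: f_def intro: less_imp_le Gamma_real_pos\<close>)
  then have "has_bochner_integral lborel (\<lambda>x. f (0 + d * x)) (Gamma (\<alpha> + 1) /\<^sub>R \<bar>d\<bar>)"
    using d by (subst (asm) lborel_has_bochner_integral_real_affine_iff[of d _ _ 0]) auto
  then have "has_bochner_integral lborel (\<lambda>x. d powr (-\<alpha>) * f (0 + d * x)) (d powr (-\<alpha>) * (Gamma (\<alpha> + 1) /\<^sub>R \<bar>d\<bar>))"
    by (rule has_bochner_integral_mult_right)
  also have "(\<lambda>t. d powr (-\<alpha>) * f (0 + d * t)) = (\<lambda>t. indicator {0..} t * t powr \<alpha> * exp (- (d * t)))"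
  proof
    show "d powr (-\<alpha>) * f (0 + d * t) = indicator {0..} t * t powr \<alpha> * exp (- (d * t))" for t
      using d by (cases "t \<ge> 0") (auto simp: f_def powr_mult powr_minus exp_minus field_simps zero_le_mult_iff)
  qed
  also have "d powr (-\<alpha>) * (Gamma (\<alpha> + 1) /\<^sub>R \<bar>d\<bar>) = Gamma (\<alpha> + 1) * d powr (- \<alpha> - 1)"
    using d by (simp add: powr_diff divide_inverse)
  finally show ?thesis .
qed

text \<open>The substitution \<open>x = exp (-t)\<close> maps the positive axis onto the open unit
  interval and turns this into Euler's Beta integral.\<close>

lemma has_bochner_integral_Beta_exp:
  fixes s \<tau> :: real
  assumes s: "s > 0" and \<tau>: "\<tau> > 0"
  shows "has_bochner_integral lborel
     (\<lambda>t. (if t > 0 then (1 - exp (-t)) powr \<tau> else 0) * exp (- (s * t))) (Beta s (\<tau> + 1))"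
proof -
  define f where "f = (\<lambda>x::real. x powr (s - 1) * (1 - x) powr (\<tau> + 1 - 1))"
  define h where "h = (\<lambda>t::real. (if t > 0 then (1 - exp (-t)) powr \<tau> else 0) * exp (- (s * t)))"
  have im: "(\<lambda>t. exp (- t)) ` {0<..} = {0<..<1::real}"
  proof (intro equalityI subsetI)
    fix x :: real assume "x \<in> {0<..<1}"
    then show "x \<in> (\<lambda>t. exp (- t)) ` {0<..}"
      by (intro image_eqI[of _ _ "- ln x"]) auto
  qed auto
  have B: "(f has_integral Beta s (\<tau> + 1)) {0<..<1}"
    using has_integral_Beta_real[of s "\<tau> + 1"] s \<tau> by (simp add: has_integral_Icc_iff_Ioo f_def)
  have "f absolutely_integrable_on {0<..<1}"
    by (rule nonnegative_absolutely_integrable_1) (use B in \<open>auto simp: f_def\<close>)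
  moreover have "((\<lambda>x. \<bar>- exp (-x)\<bar> * f (exp (-x))) absolutely_integrable_on {0<..} \<and>
      integral {0<..} (\<lambda>x. \<bar>- exp (-x)\<bar> * f (exp (-x))) = Beta s (\<tau> + 1))
     \<longleftrightarrow> f absolutely_integrable_on ((\<lambda>t. exp (-t)) ` {0<..}) \<and>
      integral ((\<lambda>t. exp (-t)) ` {0<..}) f = Beta s (\<tau> + 1)"
    by (rule has_absolute_integral_change_of_variables_1')
      (auto intro!: derivative_eq_intros inj_onI)
  ultimately have *: "(\<lambda>x. \<bar>- exp (-x)\<bar> * f (exp (-x))) absolutely_integrable_on {0<..}"
      "integral {0<..} (\<lambda>x. \<bar>- exp (-x)\<bar> * f (exp (-x))) = Beta s (\<tau> + 1)"
    using integral_unique[OF B] by (auto simp: im)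
  have h: "indicator {0<..} x *\<^sub>R (\<bar>- exp (-x)\<bar> * f (exp (-x))) = h x" for x
  proof (cases "x > 0")
    case True
    have "exp (-x) * exp (- x * (s - 1)) = exp (- (s * x))"
      unfolding mult_exp_exp by (simp add: algebra_simps)
    then show ?thesis using True by (simp add: f_def h_def exp_powr_real)
  qed (simp add: h_def)
  \<comment> \<open>The change of variables speaks of the completed measure; Borel measurability
    brings the result back to \<open>lborel\<close>.\<close>
  have "h \<in> borel_measurable lborel" unfolding h_def by measurable
  then show ?thesis
    using * set_lebesgue_integral_eq_integral(2)[OF *(1)]
    unfolding set_integrable_def set_lebesgue_integral_def h has_bochner_integral_iff
    by (simp add: integrable_completion integral_completion flip: h_def)
qed

section \<open>The Laplace transform of the Riesz mean\<close>

text \<open>The Riesz weight in logarithmic scale: with \<open>x = exp t\<close>, the weight of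
  \<open>n\<close> is the kernel at \<open>t - ln n\<close>. All weights thus become translates of
  one function.\<close>

definition riesz_kernel :: "real \<Rightarrow> real \<Rightarrow> real" where
  "riesz_kernel \<tau> t = (if t > 0 then (1 - exp (-t)) powr \<tau> else 0)"

lemma riesz_kernel_measurable [measurable]: "riesz_kernel \<tau> \<in> borel_measurable borel"
  unfolding riesz_kernel_def by measurable

lemma riesz_kernel_nonneg: "riesz_kernel \<tau> t \<ge> 0"
  by (simp add: riesz_kernel_def)

text \<open>At a fixed \<open>t\<close> only indices with \<open>Suc n < exp t\<close> contribute,
  so the series of translates is pointwise a finite sum.\<close>

lemma finite_riesz_kernel_support: "finite {n. riesz_kernel \<tau> (t - ln (real (Suc n))) \<noteq> 0}"
proof (rule finite_subset)
  show "{n. riesz_kernel \<tau> (t - ln (real (Suc n))) \<noteq> 0} \<subseteq> {..nat \<lceil>exp t\<rceil>}"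
  proof
    fix n assume "n \<in> {n. riesz_kernel \<tau> (t - ln (real (Suc n))) \<noteq> 0}"
    then have "ln (real (Suc n)) < t" by (auto simp: riesz_kernel_def split: if_splits)
    then have "exp (ln (real (Suc n))) < exp t" by (simp only: exp_less_cancel_iff)
    then have "real (Suc n) < exp t" by (simp del: of_nat_Suc)
    then show "n \<in> {..nat \<lceil>exp t\<rceil>}" by (simp, linarith)
  qed
qed simp

text \<open>Writing the finite sum, whose range varies with \<open>t\<close>, as a series over all
  \<open>n\<close> allows integration term by term.\<close>

lemma sums_riesz_mean_exp:
  assumes \<tau>: "\<tau> > 0"
  shows "(\<lambda>n. moebius (Suc n) * riesz_kernel \<tau> (t - ln (real (Suc n)))) sums
    (Gamma (\<tau> + 1) * riesz_mean \<tau> (exp t))"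
proof -
  define N where "N = {n. riesz_kernel \<tau> (t - ln (real (Suc n))) \<noteq> 0}"
  define A where "A = {n. 1 \<le> n \<and> real n \<le> exp t}"
  have finA: "finite A"
    by (rule finite_subset[of _ "{..nat \<lceil>exp t\<rceil>}"]) (auto simp: A_def, linarith)
  have kern: "riesz_kernel \<tau> (t - ln (real n)) = (if real n \<le> exp t then (1 - real n / exp t) powr \<tau> else 0)"
    if "n > 0" for n
  proof -
    have "real n < exp t \<longleftrightarrow> ln (real n) < t" "real n \<le> exp t \<longleftrightarrow> ln (real n) \<le> t"
      using that ln_less_cancel_iff[of "real n" "exp t"] ln_le_cancel_iff[of "real n" "exp t"] by simp_all
    moreover have "exp (- (t - ln (real n))) = real n / exp t"
      using that by (simp add: exp_diff)
    \<comment> \<open>At the boundary \<open>n = exp t\<close> the kernel is 0 by definition, and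
      the weight is \<open>0 powr \<tau> = 0\<close>.\<close>
    moreover have "real n / exp t = 1" if "ln (real n) = t"
      using that \<open>n > 0\<close> by auto
    ultimately show ?thesis unfolding riesz_kernel_def by auto
  qed
  have "(\<lambda>n. moebius (Suc n) * riesz_kernel \<tau> (t - ln (real (Suc n)))) sums
      (\<Sum>n\<in>N. moebius (Suc n) * riesz_kernel \<tau> (t - ln (real (Suc n))))"
    by (rule sums_finite) (use finite_riesz_kernel_support in \<open>auto simp: N_def\<close>)
  also have "(\<Sum>n\<in>N. moebius (Suc n) * riesz_kernel \<tau> (t - ln (real (Suc n)))) =
      (\<Sum>n\<in>Suc ` N. moebius n * riesz_kernel \<tau> (t - ln (real n)))"
    by (simp add: sum.reindex)
  also have "\<dots> = (\<Sum>n\<in>A. moebius n * riesz_kernel \<tau> (t - ln (real n)))"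
  proof (rule sum.mono_neutral_left[OF finA])
    show "Suc ` N \<subseteq> A"
    proof
      fix n assume "n \<in> Suc ` N"
      then have "n > 0" "riesz_kernel \<tau> (t - ln (real n)) \<noteq> 0" by (auto simp: N_def)
      then show "n \<in> A" using kern[of n] by (auto simp: A_def split: if_splits)
    qed
    show "\<forall>n\<in>A - Suc ` N. moebius n * riesz_kernel \<tau> (t - ln (real n)) = 0"
    proof
      fix n assume "n \<in> A - Suc ` N"
      moreover from this obtain k where "n = Suc k" by (cases n) (auto simp: A_def)
      ultimately show "moebius n * riesz_kernel \<tau> (t - ln (real n)) = 0"
        by (auto simp: N_def)
    qed
  qed
  also have "\<dots> = (\<Sum>n\<in>A. moebius n * (1 - real n / exp t) powr \<tau>)"
    by (intro sum.cong refl) (use kern in \<open>auto simp: A_def\<close>)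
  also have "\<dots> = Gamma (\<tau> + 1) * riesz_mean \<tau> (exp t)"
    using \<tau> less_imp_neq[OF Gamma_real_pos[of "\<tau> + 1"]] by (simp add: riesz_mean_def A_def)
  finally show ?thesis .
qed

lemma riesz_mean_exp_measurable:
  assumes "\<tau> > 0"
  shows "(\<lambda>t. riesz_mean \<tau> (exp t)) \<in> borel_measurable borel"
proof -
  have "(\<lambda>t. riesz_mean \<tau> (exp t)) =
      (\<lambda>t. (\<Sum>n. moebius (Suc n) * riesz_kernel \<tau> (t - ln (real (Suc n)))) / Gamma (\<tau> + 1))"
    using sums_riesz_mean_exp[OF assms] less_imp_neq[OF Gamma_real_pos[of "\<tau> + 1"]] assms by (simp add: sums_iff fun_eq_iff)
  also have "\<dots> \<in> borel_measurable borel" by measurable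
  finally show ?thesis .
qed

lemma riesz_mean_eq_0:
  assumes "x < 1"
  shows "riesz_mean \<tau> x = 0"
proof -
  have "{n. 1 \<le> n \<and> real n \<le> x} = {}" using assms by auto
  then show ?thesis unfolding riesz_mean_def by (simp only: sum.empty mult_zero_right)
qed

text \<open>At most \<open>x\<close> terms occur, each of modulus at most 1. This crude bound serves
  on bounded ranges, about which an asymptotic hypothesis says nothing.\<close>

lemma abs_riesz_mean_le:
  assumes \<tau>: "\<tau> > 0" and x: "x > 0"
  shows "\<bar>riesz_mean \<tau> x\<bar> \<le> x / Gamma (\<tau> + 1)"
proof -
  define A where "A = {n. 1 \<le> n \<and> real n \<le> x}"
  have A: "A = {1..nat \<lfloor>x\<rfloor>}" using x by (auto simp: A_def le_nat_floor) linarith+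
  have "\<bar>\<Sum>n\<in>A. moebius n * (1 - real n / x) powr \<tau>\<bar> \<le> (\<Sum>n\<in>A. \<bar>moebius n * (1 - real n / x) powr \<tau>\<bar>)"
    by (rule sum_abs)
  also have "\<dots> \<le> (\<Sum>n\<in>A. 1)"
  proof (rule sum_mono)
    fix n assume "n \<in> A"
    then have "(1 - real n / x) powr \<tau> \<le> 1"
      using x \<tau> by (intro powr_le1) (auto simp: A_def field_simps)
    then have "\<bar>moebius n\<bar> * (1 - real n / x) powr \<tau> \<le> 1"
      using abs_moebius_le_1[of n] by (intro mult_le_one) auto
    then show "\<bar>moebius n * (1 - real n / x) powr \<tau>\<bar> \<le> 1" by (simp add: abs_mult)
  qed
  also have "\<dots> \<le> x" using x by (simp add: A)
  finally show ?thesis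
    using \<tau> Gamma_real_pos[of "\<tau> + 1"]
    by (simp add: riesz_mean_def A_def abs_mult divide_right_mono)
qed

text \<open>Translating the kernel by \<open>ln n\<close> multiplies its transform
  \<open>Beta s (\<tau> + 1)\<close> by \<open>n powr (-s)\<close>. Summation against the Moebius
  function then produces the reciprocal of zeta.\<close>

lemma integral_riesz_mean_times_zeta:
  assumes \<tau>: "\<tau> > 0" and s: "s > 1"
  shows "(LINT t|lborel. riesz_mean \<tau> (exp t) * exp (- (s * t))) * Re (zeta (of_real s)) =
    Gamma s / Gamma (s + \<tau> + 1)"
proof -
  define B where "B = Beta s (\<tau> + 1)"
  have Gpos: "Gamma (\<tau> + 1) > 0" using \<tau> by simp
  define k where "k = (\<lambda>n t. riesz_kernel \<tau> (t - ln (real (Suc n))) * exp (- (s * t)))"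
  have k: "has_bochner_integral lborel (k n) (real (Suc n) powr (-s) * B)" for n
  proof -
    define l where "l = ln (real (Suc n))"
    have "has_bochner_integral lborel (\<lambda>t. riesz_kernel \<tau> t * exp (- (s * t))) B"
      using has_bochner_integral_Beta_exp[of s \<tau>] s \<tau> by (simp add: riesz_kernel_def B_def)
    then have "has_bochner_integral lborel (\<lambda>t. riesz_kernel \<tau> (-l + 1 * t) * exp (- (s * (-l + 1 * t)))) B"
      by (subst (asm) lborel_has_bochner_integral_real_affine_iff[of 1 _ _ "-l"]) auto
    then have "has_bochner_integral lborel
        (\<lambda>t. exp (- s * l) * (riesz_kernel \<tau> (-l + 1 * t) * exp (- (s * (-l + 1 * t))))) (exp (- s * l) * B)"
      by (rule has_bochner_integral_mult_right)
    also have "(\<lambda>t. exp (- s * l) * (riesz_kernel \<tau> (-l + 1 * t) * exp (- (s * (-l + 1 * t))))) = k n"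
    proof
      fix t
      have "exp (- s * l) * exp (- (s * (-l + 1 * t))) = exp (- (s * t))"
        unfolding mult_exp_exp by (simp add: algebra_simps)
      then show "exp (- s * l) * (riesz_kernel \<tau> (-l + 1 * t) * exp (- (s * (-l + 1 * t)))) = k n t"
        by (simp add: k_def l_def)
    qed
    also have "exp (- s * l) = real (Suc n) powr (-s)"
      by (simp add: powr_def l_def)
    finally show ?thesis .
  qed
  define h where "h = (\<lambda>n t. moebius (Suc n) * k n t)"
  have hint: "integrable lborel (h n)" "integral\<^sup>L lborel (h n) = moebius (Suc n) * (real (Suc n) powr (-s) * B)" for n
    using k[of n] unfolding h_def by (auto simp: has_bochner_integral_iff simp del: of_nat_Suc)
  \<comment> \<open>Sum and integral may be exchanged: the integrals of the absolute values are at
    most \<open>real (Suc n) powr (-s) * B\<close>, which is summable for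
    \<open>s > 1\<close>.\<close>
  have "(\<lambda>n. integral\<^sup>L lborel (h n)) sums (LINT t|lborel. (\<Sum>n. h n t))"
  proof (rule sums_integral)
    show "AE t in lborel. summable (\<lambda>n. norm (h n t))"
    proof (rule AE_I2)
      show "summable (\<lambda>n. norm (h n t))" for t
        by (rule summable_finite[OF finite_riesz_kernel_support[of \<tau> t]]) (auto simp: h_def k_def)
    qed
    show "summable (\<lambda>n. LINT t|lborel. norm (h n t))"
    proof (rule summable_comparison_test')
      show "summable (\<lambda>n. real (Suc n) powr (-s) * B)"
        using summable_Suc_powr[OF s] by (rule summable_mult2)
      fix n
      have "(LINT t|lborel. norm (h n t)) \<le> (LINT t|lborel. k n t)"
      proof (rule integral_mono)
        show "norm (h n t) \<le> k n t" for t
          using mult_right_mono[OF abs_moebius_le_1[of "Suc n"], of "k n t"] riesz_kernel_nonneg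
          by (simp add: h_def k_def abs_mult)
      qed (use k hint in \<open>auto simp: has_bochner_integral_iff\<close>)
      then show "norm (LINT t|lborel. norm (h n t)) \<le> real (Suc n) powr (-s) * B"
        using k[of n] by (simp add: has_bochner_integral_iff)
    qed
  qed (fact hint)
  moreover have "(\<Sum>n. h n t) = Gamma (\<tau> + 1) * (riesz_mean \<tau> (exp t) * exp (- (s * t)))" for t
    using sums_mult2[OF sums_riesz_mean_exp[OF \<tau>, of t], of "exp (- (s * t))"]
    by (simp add: sums_iff h_def k_def mult_ac)
  ultimately have "(\<lambda>n. moebius (Suc n) * (real (Suc n) powr (-s) * B)) sums
      (Gamma (\<tau> + 1) * (LINT t|lborel. riesz_mean \<tau> (exp t) * exp (- (s * t))))"
    unfolding hint by simp
  moreover have "(\<lambda>n. moebius (Suc n) * (real (Suc n) powr (-s) * B)) sums (1 / Re (zeta (of_real s)) * B)"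
    using sums_mult2[OF sums_moebius_powr(2)[OF s], of B] by (simp add: mult_ac del: of_nat_Suc)
  ultimately have *: "Gamma (\<tau> + 1) * (LINT t|lborel. riesz_mean \<tau> (exp t) * exp (- (s * t))) =
      1 / Re (zeta (of_real s)) * B"
    by (rule sums_unique2)
  have "Re (zeta (of_real s)) \<noteq> 0"
    using sums_moebius_powr(1)[OF s] zeta_of_real[OF s] by auto
  then have "Gamma (\<tau> + 1) * ((LINT t|lborel. riesz_mean \<tau> (exp t) * exp (- (s * t))) * Re (zeta (of_real s))) = B"
    using * by (simp flip: mult.assoc)
  also have "B = Gamma (\<tau> + 1) * (Gamma s / Gamma (s + \<tau> + 1))"
    using s \<tau> by (simp add: B_def Beta_def add_ac)
  finally show ?thesis
    unfolding mult_left_cancel[OF less_imp_neq[OF Gpos, symmetric]] .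
qed

lemma laplace_of_real:
  "laplace f (of_real s) = of_real (LINT t|lborel. f t * exp (- (s * t)))"
proof -
  have "laplace f (of_real s) = (LINT t|lborel. of_real (f t * exp (- (s * t))))"
    unfolding laplace_def by (intro Bochner_Integration.integral_cong) (simp_all flip: exp_of_real)
  then show ?thesis by (simp only: integral_complex_of_real)
qed

text \<open>Identity theorem: both sides are holomorphic on the half-plane without 1, which is
  connected, and agree on the real ray beyond 1, which accumulates at 2. Here
  \<open>a \<ge> 0\<close> avoids the poles of Gamma, and \<open>a \<le> 1\<close> keeps the ray
  inside.\<close>

lemma laplace_riesz_mean_times_zeta:
  assumes \<tau>: "\<tau> > 0" and a: "0 \<le> a" "a \<le> 1"
    and int: "\<And>\<sigma>. \<sigma> > a \<Longrightarrow> integrable lborel (\<lambda>t. riesz_mean \<tau> (exp t) * exp (- (\<sigma> * t)))"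
    and s: "Re s > a" "s \<noteq> 1"
  shows "laplace (\<lambda>t. riesz_mean \<tau> (exp t)) s * zeta s = Gamma s * rGamma (s + of_real (\<tau> + 1))"
proof -
  define F where "F = laplace (\<lambda>t. riesz_mean \<tau> (exp t))"
  define S where "S = {s. Re s > a} - {1}"
  have F: "F holomorphic_on {s. Re s > a}"
    unfolding F_def by (rule laplace_holomorphic[OF int]) (auto intro: riesz_mean_eq_0)
  have Z: "zeta holomorphic_on - {1}" using is_zeta_zeta by (simp add: is_zeta_def)
  have "F s * zeta s - Gamma s * rGamma (s + of_real (\<tau> + 1)) = 0"
  proof (rule analytic_continuation[of "\<lambda>s. F s * zeta s - Gamma s * rGamma (s + of_real (\<tau> + 1))" S
        "of_real ` {1<..}" 2])
    have "s \<notin> \<int>\<^sub>\<le>\<^sub>0" if "s \<in> S" for s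
      using that a by (auto simp: S_def nonpos_Ints_def)
    then show "(\<lambda>s. F s * zeta s - Gamma s * rGamma (s + of_real (\<tau> + 1))) holomorphic_on S"
      by (intro holomorphic_intros holomorphic_on_subset[OF F] holomorphic_on_subset[OF Z])
        (auto simp: S_def)
    show "open S" unfolding S_def by (intro open_Diff open_halfspace_Re_gt) auto
    show "connected S"
      unfolding S_def
      by (intro connected_open_delete open_halfspace_Re_gt convex_connected convex_halfspace_Re_gt) simp
    show "of_real ` {1<..} \<subseteq> S" "2 \<in> S" using a by (auto simp: S_def)
    show "2 islimpt (of_real ` {1<..} :: complex set)"
      unfolding islimpt_approachable
    proof safe
      fix e :: real assume "e > 0"
      then show "\<exists>x'\<in>of_real ` {1<..}. x' \<noteq> 2 \<and> dist x' (2::complex) < e"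
        by (intro bexI[of _ "of_real (2 + e / 2)"] imageI) (auto simp: dist_norm)
    qed
    show "s \<in> S" using s by (simp add: S_def)
    fix z :: complex assume "z \<in> of_real ` {1<..}"
    then obtain x where x: "z = of_real x" "x > 1" by auto
    have "F z * zeta z = of_real (Gamma x / Gamma (x + \<tau> + 1))"
      unfolding integral_riesz_mean_times_zeta[OF \<tau> x(2), symmetric] x(1) F_def laplace_of_real
      using zeta_of_real[OF x(2)] by simp
    also have "\<dots> = Gamma z * rGamma (z + of_real (\<tau> + 1))"
    proof -
      have "z + of_real (\<tau> + 1) = of_real (x + \<tau> + 1)" by (simp add: x)
      then show ?thesis
        by (simp only: x rGamma_inverse_Gamma divide_inverse Gamma_complex_of_real of_real_mult of_real_inverse)
    qed
    finally show "F z * zeta z - Gamma z * rGamma (z + of_real (\<tau> + 1)) = 0" by simp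
  qed
  then show ?thesis by (simp add: F_def)
qed

section \<open>Behaviour near a zero on the critical line\<close>

lemma norm_laplace_le:
  "norm (laplace f s) \<le> (LINT t|lborel. \<bar>f t * exp (- (Re s * t))\<bar>)"
proof -
  have "norm (laplace f s) \<le> (LINT t|lborel. norm (of_real (f t) * exp (- (s * of_real t)) :: complex))"
    unfolding laplace_def by (rule integral_norm_bound)
  then show ?thesis by (simp add: norm_laplace_integrand abs_mult)
qed

text \<open>The integral is split at a point \<open>T\<close> beyond which the growth bound holds.
  The part up to \<open>T\<close> gives a constant \<open>C\<close> independent of
  \<open>\<sigma>\<close>; the tail is at most \<open>\<epsilon>\<close> times a Gamma integral.
  Hence the blow-up at \<open>a\<close> carries the small factor \<open>\<epsilon>\<close>.\<close>

lemma laplace_growth_bound: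
  fixes f :: "real \<Rightarrow> real" and a \<alpha> \<epsilon> K :: real
  assumes [measurable]: "f \<in> borel_measurable borel"
    and neg: "\<And>t. t < 0 \<Longrightarrow> f t = 0"
    and K: "\<And>t. \<bar>f t\<bar> \<le> K * exp t"
    and a: "a \<ge> 0" and \<alpha>: "\<alpha> > -1" and \<epsilon>: "\<epsilon> > 0"
    and growth: "\<forall>\<^sub>F t in at_top. \<bar>f t\<bar> \<le> \<epsilon> * (exp (a * t) * t powr \<alpha>)"
  obtains C where
    "\<And>\<sigma>. \<sigma> > a \<Longrightarrow> integrable lborel (\<lambda>t. f t * exp (- (\<sigma> * t)))"
    "\<And>\<sigma>. \<sigma> > a \<Longrightarrow> (LINT t|lborel. \<bar>f t * exp (- (\<sigma> * t))\<bar>) \<le>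
       C + \<epsilon> * (Gamma (\<alpha> + 1) * (\<sigma> - a) powr (-\<alpha> - 1))"
proof -
  obtain T where T: "T \<ge> 0" "\<And>t. t \<ge> T \<Longrightarrow> \<bar>f t\<bar> \<le> \<epsilon> * (exp (a * t) * t powr \<alpha>)"
  proof -
    obtain T0 where "\<And>t. t \<ge> T0 \<Longrightarrow> \<bar>f t\<bar> \<le> \<epsilon> * (exp (a * t) * t powr \<alpha>)"
      using growth by (auto simp: eventually_at_top_linorder)
    then show ?thesis by (intro that[of "max 0 T0"]) auto
  qed
  have "K \<ge> 0" using order_trans[OF abs_ge_zero K[of 0]] by simp
  \<comment> \<open>The second summand extends over all \<open>t \<ge> 0\<close> instead of
    \<open>t \<ge> T\<close>, so that its integral is exactly a Gamma integral; being nonnegative it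
    only enlarges the majorant.\<close>
  define w where "w = (\<lambda>\<sigma> t. K * exp T * indicator {0..T} t +
      \<epsilon> * (indicator {0..} t * t powr \<alpha> * exp (- ((\<sigma> - a) * t))))"
  have w: "has_bochner_integral lborel (w \<sigma>) (K * exp T * T + \<epsilon> * (Gamma (\<alpha> + 1) * (\<sigma> - a) powr (-\<alpha> - 1)))"
    if "\<sigma> > a" for \<sigma>
    unfolding w_def
  proof (intro has_bochner_integral_add has_bochner_integral_mult_right has_bochner_integral_powr_exp \<alpha>)
    show "has_bochner_integral lborel (indicator {0..T}) T"
      using T(1) has_bochner_integral_real_indicator[of "{0..T}" lborel] by simp
  qed (use that in auto)
  have le: "\<bar>f t * exp (- (\<sigma> * t))\<bar> \<le> w \<sigma> t" if \<sigma>: "\<sigma> > a" for \<sigma> t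
  proof (cases "t < 0")
    case True
    then show ?thesis using neg T by (simp add: w_def)
  next
    case False
    show ?thesis
    proof (cases "t \<le> T")
      case True
      have "\<bar>f t * exp (- (\<sigma> * t))\<bar> \<le> (K * exp T) * 1"
        unfolding abs_mult
      proof (intro mult_mono)
        show "\<bar>f t\<bar> \<le> K * exp T"
          using K[of t] mult_left_mono[of "exp t" "exp T" K] True \<open>K \<ge> 0\<close> by simp
        show "\<bar>exp (- (\<sigma> * t))\<bar> \<le> 1" using \<sigma> a False by simp
      qed (use \<open>K \<ge> 0\<close> in auto)
      also have "\<dots> \<le> w \<sigma> t" using True False \<epsilon> by (simp add: w_def)
      finally show ?thesis .
    next
      case t: False
      have "\<bar>f t * exp (- (\<sigma> * t))\<bar> \<le> \<epsilon> * (exp (a * t) * t powr \<alpha>) * exp (- (\<sigma> * t))"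
        unfolding abs_mult using T(2)[of t] t by (intro mult_mono) auto
      also have "\<dots> = \<epsilon> * (t powr \<alpha> * (exp (a * t) * exp (- (\<sigma> * t))))" by simp
      also have "exp (a * t) * exp (- (\<sigma> * t)) = exp (- ((\<sigma> - a) * t))"
        unfolding mult_exp_exp by (simp add: algebra_simps)
      also have "\<epsilon> * (t powr \<alpha> * exp (- ((\<sigma> - a) * t))) = w \<sigma> t"
        using t False by (simp add: w_def)
      finally show ?thesis .
    qed
  qed
  have int: "integrable lborel (\<lambda>t. f t * exp (- (\<sigma> * t)))" if \<sigma>: "\<sigma> > a" for \<sigma>
  proof (rule Bochner_Integration.integrable_bound)
    show "integrable lborel (w \<sigma>)" using w[OF \<sigma>] by (simp add: has_bochner_integral_iff)
    show "AE t in lborel. norm (f t * exp (- (\<sigma> * t))) \<le> norm (w \<sigma> t)"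
      using le[OF \<sigma>] by (auto intro!: AE_I2 intro: order_trans[OF _ abs_ge_self] simp only: real_norm_def)
  qed measurable
  have "(LINT t|lborel. \<bar>f t * exp (- (\<sigma> * t))\<bar>) \<le>
       K * exp T * T + \<epsilon> * (Gamma (\<alpha> + 1) * (\<sigma> - a) powr (-\<alpha> - 1))" if \<sigma>: "\<sigma> > a" for \<sigma>
  proof -
    have "(LINT t|lborel. \<bar>f t * exp (- (\<sigma> * t))\<bar>) \<le> (LINT t|lborel. w \<sigma> t)"
      using w[OF \<sigma>] int[OF \<sigma>] le[OF \<sigma>] by (intro integral_mono) (auto simp: has_bochner_integral_iff)
    then show ?thesis using w[OF \<sigma>] by (simp add: has_bochner_integral_iff)
  qed
  then show ?thesis using that int by blast
qed

lemma zeta_zorder_expansion: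
  assumes \<rho>: "zeta \<rho> = 0" "\<rho> \<noteq> 1"
  obtains g where "zorder zeta \<rho> > 0" "isCont g \<rho>"
    "\<forall>\<^sub>F d in at_right 0. zeta (\<rho> + of_real d) = g (\<rho> + of_real d) * of_real (d ^ nat (zorder zeta \<rho>))"
proof -
  define g where "g = zor_poly zeta \<rho>"
  define n where "n = zorder zeta \<rho>"
  have Z: "zeta holomorphic_on - {1}" using is_zeta_zeta by (simp add: is_zeta_def)
  have conn: "connected (- {1::complex})" by (rule connected_punctured_universe) simp
  \<comment> \<open>The point 2 witnesses that zeta is not identically 0, so its zeros have finite
    order.\<close>
  have nz: "\<exists>w\<in>-{1}. zeta w \<noteq> 0"
    using sums_moebius_powr(1)[of 2] by (intro bexI[of _ "of_real 2"]) auto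
  obtain r where r: "n > 0" "r > 0" "g holomorphic_on cball \<rho> r"
      "\<And>w. w \<in> cball \<rho> r \<Longrightarrow> zeta w = g w * (w - \<rho>) ^ nat n"
    using zorder_exist_zero[OF Z open_Compl[OF closed_singleton] conn _ nz, of \<rho>] \<rho> unfolding g_def n_def by auto
  have "continuous_on (ball \<rho> r) g"
    using r(3) by (meson ball_subset_cball holomorphic_on_imp_continuous_on holomorphic_on_subset)
  then have "isCont g \<rho>" using r(2) by (simp add: continuous_on_eq_continuous_at)
  moreover have "\<forall>\<^sub>F d in at_right 0. zeta (\<rho> + of_real d) = g (\<rho> + of_real d) * of_real (d ^ nat n)"
    using eventually_at_right_real[OF r(2)]
  proof eventually_elim
    case (elim d)
    then show ?case using r(4)[of "\<rho> + of_real d"] by (simp add: dist_norm)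
  qed
  ultimately show ?thesis using that[of g] r(1) by (simp add: n_def)
qed

text \<open>If the order \<open>m\<close> were at least \<open>\<alpha> + 1\<close>, the factor
  \<open>d ^ m\<close> of zeta would compensate the growth \<open>d powr (-\<alpha> - 1)\<close> of
  the transform. Then the nonzero value \<open>H \<rho>\<close> would be bounded by a fixed multiple
  of every \<open>\<epsilon> > 0\<close>.\<close>

lemma zorder_less_of_riesz_mean:
  assumes \<tau>: "\<tau> > 0" and \<alpha>: "\<alpha> > -1"
    and M: "riesz_mean \<tau> \<in> o[at_top](\<lambda>x. x powr (1/2) * ln x powr \<alpha>)"
    and \<rho>: "zeta \<rho> = 0" "Re \<rho> = 1 / 2"
  shows "real_of_int (zorder zeta \<rho>) < \<alpha> + 1"
proof (rule ccontr)
  assume *: "\<not> ?thesis"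
  define f where "f = (\<lambda>t. riesz_mean \<tau> (exp t))"
  define m where "m = nat (zorder zeta \<rho>)"
  have "\<rho> \<noteq> 1" using \<rho>(2) by auto
  then obtain g where g: "zorder zeta \<rho> > 0" "isCont g \<rho>"
    "\<forall>\<^sub>F d in at_right 0. zeta (\<rho> + of_real d) = g (\<rho> + of_real d) * of_real (d ^ m)"
    using zeta_zorder_expansion \<rho>(1) unfolding m_def by metis
  have m: "m > 0" "real m \<ge> \<alpha> + 1" using g(1) * by (auto simp: m_def)
  define H where "H = (\<lambda>s::complex. Gamma s * rGamma (s + of_real (\<tau> + 1)))"
  define c where "c = norm (H \<rho>)"
  have nonpole: "\<rho> \<notin> \<int>\<^sub>\<le>\<^sub>0" "\<rho> + of_real (\<tau> + 1) \<notin> \<int>\<^sub>\<le>\<^sub>0"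
    using \<rho>(2) \<tau> by (auto elim!: nonpos_Ints_cases dest!: arg_cong[of _ _ Re])
  \<comment> \<open>Gamma has no zeros off its poles, and \<open>rGamma\<close> vanishes only at the
    poles of Gamma.\<close>
  have "H \<rho> \<noteq> 0" using nonpole unfolding H_def by (simp add: Gamma_eq_zero_iff rGamma_eq_zero_iff)
  then have c: "c > 0" by (simp add: c_def)
  have contH: "isCont H \<rho>"
    unfolding H_def using nonpole by (intro continuous_intros) auto
  define G where "G = Gamma (\<alpha> + 1)"
  have G: "G > 0" using \<alpha> by (simp add: G_def)
  have shift: "((\<lambda>d. \<rho> + of_real d) \<longlongrightarrow> \<rho>) (at_right 0)"
    by (auto intro!: tendsto_eq_intros)
  have bound: "c \<le> norm (g \<rho>) * (\<epsilon> * G)" if \<epsilon>: "\<epsilon> > 0" for \<epsilon>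
  proof -
    have growth: "\<forall>\<^sub>F t in at_top. \<bar>f t\<bar> \<le> \<epsilon> * (exp (1/2 * t) * t powr \<alpha>)"
    proof -
      have "\<forall>\<^sub>F x in at_top. norm (riesz_mean \<tau> x) \<le> \<epsilon> * norm (x powr (1/2) * ln x powr \<alpha>)"
        using M \<epsilon> by (rule landau_o.smallD)
      then have "\<forall>\<^sub>F t in at_top. norm (riesz_mean \<tau> (exp t)) \<le> \<epsilon> * norm (exp t powr (1/2) * ln (exp t) powr \<alpha>)"
        by (rule eventually_compose_filterlim[OF _ exp_at_top])
      then show ?thesis
        by eventually_elim (simp add: f_def exp_powr_real abs_mult mult_ac)
    qed
    obtain C where int: "\<And>\<sigma>. \<sigma> > 1/2 \<Longrightarrow> integrable lborel (\<lambda>t. f t * exp (- (\<sigma> * t)))"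
      and C: "\<And>\<sigma>. \<sigma> > 1/2 \<Longrightarrow> (LINT t|lborel. \<bar>f t * exp (- (\<sigma> * t))\<bar>) \<le>
         C + \<epsilon> * (Gamma (\<alpha> + 1) * (\<sigma> - 1/2) powr (-\<alpha> - 1))"
    proof (rule laplace_growth_bound[OF _ _ _ _ \<alpha> \<epsilon> growth])
      show "f \<in> borel_measurable borel" unfolding f_def by (rule riesz_mean_exp_measurable[OF \<tau>])
      show "f t = 0" if "t < 0" for t using that by (simp add: f_def riesz_mean_eq_0)
      show "\<bar>f t\<bar> \<le> 1 / Gamma (\<tau> + 1) * exp t" for t
        using abs_riesz_mean_le[OF \<tau>, of "exp t"] by (simp add: f_def)
    qed auto
    \<comment> \<open>The bound \<open>d < 1/2\<close> keeps \<open>Re s\<close> below 1, away from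
      the pole of zeta.\<close>
    have ev: "\<forall>\<^sub>F d in at_right (0::real). 0 < d \<and> d < 1/2"
      using eventually_at_right_real[of 0 "1/2"] by (simp add: eventually_conj_iff)
    have "\<forall>\<^sub>F d in at_right 0. norm (H (\<rho> + of_real d)) \<le>
        norm (g (\<rho> + of_real d)) * (\<bar>C\<bar> * d + \<epsilon> * G)"
      using g(3) ev
    proof eventually_elim
      case (elim d)
      define s where "s = \<rho> + of_real d"
      have re: "Re s = 1/2 + d" using \<rho>(2) by (simp add: s_def)
      have "Re s \<noteq> 1" using re elim by simp
      then have "s \<noteq> 1" by auto
      then have "H s = laplace f s * zeta s"
        unfolding H_def f_def using laplace_riesz_mean_times_zeta[OF \<tau>, of "1/2" s] int re elim
        by (simp add: f_def)
      also have "norm \<dots> = norm (g s) * (norm (laplace f s) * d ^ m)"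
        using elim by (simp add: norm_mult norm_power s_def)
      also have "\<dots> \<le> norm (g s) * ((\<bar>C\<bar> + \<epsilon> * (G * d powr (-\<alpha> - 1))) * d ^ m)"
      proof (intro mult_left_mono mult_right_mono)
        show "norm (laplace f s) \<le> \<bar>C\<bar> + \<epsilon> * (G * d powr (-\<alpha> - 1))"
          using norm_laplace_le[of f s] C[of "Re s"] re elim by (simp add: G_def)
      qed (use elim in auto)
      also have "\<dots> \<le> norm (g s) * (\<bar>C\<bar> * d + \<epsilon> * G)"
      proof (rule mult_left_mono)
        \<comment> \<open>Since \<open>m \<ge> 1\<close>, the term with the constant
          \<open>C\<close> vanishes in the limit, although \<open>C\<close> depends on
          \<open>\<epsilon>\<close>.\<close>
        have "d ^ m \<le> d ^ 1" using elim m by (intro power_decreasing) auto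
        \<comment> \<open>Here the assumption \<open>m \<ge> \<alpha> + 1\<close> enters: the
          combined exponent of \<open>d\<close> is nonnegative and \<open>d < 1\<close>.\<close>
        moreover have "d powr (-\<alpha> - 1) * d ^ m \<le> 1"
        proof -
          have "d powr (-\<alpha> - 1) * d ^ m = d powr (real m - \<alpha> - 1)"
            using elim by (simp add: powr_realpow[symmetric] algebra_simps flip: powr_add)
          also have "\<dots> \<le> 1" using elim m(2) by (intro powr_le1) auto
          finally show ?thesis .
        qed
        then have "\<epsilon> * (G * (d powr (-\<alpha> - 1) * d ^ m)) \<le> \<epsilon> * (G * 1)"
          using \<epsilon> G by (intro mult_left_mono) auto
        ultimately show "(\<bar>C\<bar> + \<epsilon> * (G * d powr (-\<alpha> - 1))) * d ^ m \<le> \<bar>C\<bar> * d + \<epsilon> * G"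
          using mult_left_mono[of "d ^ m" d "\<bar>C\<bar>"] by (simp add: algebra_simps)
      qed simp
      finally show ?case by (simp add: s_def)
    qed
    moreover have "((\<lambda>d. norm (H (\<rho> + of_real d))) \<longlongrightarrow> c) (at_right 0)"
      unfolding c_def by (intro tendsto_norm isCont_tendsto_compose[OF contH] shift)
    moreover have "((\<lambda>d. norm (g (\<rho> + of_real d)) * (\<bar>C\<bar> * d + \<epsilon> * G)) \<longlongrightarrow>
        norm (g \<rho>) * (\<bar>C\<bar> * 0 + \<epsilon> * G)) (at_right 0)"
      by (intro tendsto_intros isCont_tendsto_compose[OF g(2)] shift)
    ultimately show ?thesis
      using tendsto_le[OF trivial_limit_at_right_real] by force
  qed
  \<comment> \<open>Adding 1 makes \<open>N\<close> safe to divide by; \<open>\<epsilon>\<close> is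
    then chosen so that \<open>N * (\<epsilon> * G) = c / 2\<close>.\<close>
  define N where "N = norm (g \<rho>) + 1"
  have N: "N > 0" by (simp add: N_def add_nonneg_pos)
  define \<epsilon> where "\<epsilon> = c / (2 * G * N)"
  have \<epsilon>: "\<epsilon> > 0" using c G N by (simp add: \<epsilon>_def)
  then have "c \<le> norm (g \<rho>) * (\<epsilon> * G)" by (rule bound)
  also have "\<dots> \<le> N * (\<epsilon> * G)" using \<epsilon> G by (simp add: N_def)
  also have "\<dots> = c / 2" using G N by (simp add: \<epsilon>_def)
  finally show False using c by simp
qed

theorem theorem1:
  fixes \<alpha> :: real
  assumes "riemann_hypothesis"
    and "\<exists>\<tau>>0. riesz_mean \<tau> \<in> o[at_top](\<lambda>x. x powr (1/2) * ln x powr \<alpha>)"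
  shows "\<forall>\<rho>. nontrivial_zero \<rho> \<longrightarrow> real_of_int (zorder zeta \<rho>) < \<alpha> + 1"
proof (intro allI impI)
  fix \<rho> assume \<rho>: "nontrivial_zero \<rho>"
  then have \<rho>0: "zeta \<rho> = 0" "Re \<rho> = 1 / 2" "\<rho> \<noteq> 1"
    using assms(1) by (auto simp: nontrivial_zero_def riemann_hypothesis_def)
  obtain \<tau> where \<tau>: "\<tau> > 0" "riesz_mean \<tau> \<in> o[at_top](\<lambda>x. x powr (1/2) * ln x powr \<alpha>)"
    using assms(2) by blast
  \<comment> \<open>The growth estimate needs an exponent above \<open>-1\<close>. Enlarging \<open>\<alpha>\<close> to at least \<open>-1/2\<close> loses nothing:
    a zero has order at least 1, so the bound \<open>\<beta> + 1\<close> must exceed 1 and then \<open>\<beta> = \<alpha>\<close>.\<close>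
  define \<beta> where "\<beta> = max \<alpha> (-1/2)"
  have "(\<lambda>x. x powr (1/2) * ln x powr \<alpha>) \<in> O[at_top](\<lambda>x. x powr (1/2) * ln x powr \<beta>)"
  proof (rule landau_o.bigI[of 1])
    show "\<forall>\<^sub>F x in at_top. norm (x powr (1/2) * ln x powr \<alpha>) \<le> 1 * norm (x powr (1/2) * ln x powr \<beta>)"
      \<comment> \<open>From \<open>exp 1\<close> on, \<open>ln x \<ge> 1\<close>, so its powers
        increase with the exponent.\<close>
      using eventually_ge_at_top[of "exp 1"]
    proof eventually_elim
      case (elim x)
      then have "ln x \<ge> 1" by (subst ln_ge_iff) (auto intro: less_le_trans[OF exp_gt_zero])
      then have "ln x powr \<alpha> \<le> ln x powr \<beta>" by (intro powr_mono) (auto simp: \<beta>_def)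
      then show ?case by (simp add: abs_mult mult_left_mono)
    qed
  qed simp
  then have "riesz_mean \<tau> \<in> o[at_top](\<lambda>x. x powr (1/2) * ln x powr \<beta>)"
    using \<tau>(2) by (rule landau_o.small_big_trans[rotated])
  then have "real_of_int (zorder zeta \<rho>) < \<beta> + 1"
    by (intro zorder_less_of_riesz_mean[OF \<tau>(1) _ _ \<rho>0(1,2)]) (simp_all add: \<beta>_def)
  moreover have "zorder zeta \<rho> \<ge> 1"
    using zeta_zorder_expansion[OF \<rho>0(1,3)] by (metis int_one_le_iff_zero_less)
  ultimately show "real_of_int (zorder zeta \<rho>) < \<alpha> + 1" by (auto simp: \<beta>_def max_def split: if_splits)
qed

end
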